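(* Let $\psi$ be a path formula (an $\mathrm{LTL}$ formula) and let $x$ be an atomic proposition occurring in $\psi$. Then for every Kripke structure $K$ whose atomic propositions do not include $x$, $$K\models_T \forall x\, A\psi \iff K\models_b \forall x\, A\psi.$$
   Context: A Kripke structure $K=(AP,S,R,s_0,I)$ consists of atomic propositions $AP$, a finite set $S$ of states, a total transition relation $R\subseteq S\times S$, an initial state $s_0$ and labeling $I:S\to 2^{AP}$; $\mathrm{CTL}^*$ has the standard semantics (also over infinite structures such as trees), and $K\models\varphi$ means $K,s_0\models\varphi$. The computation tree $T(K)$ is the (possibly infinite) $S$-labeled tree obtained by unrolling $K$ from $s_0$: the root is labeled $s_0$ and each node labeled $s$ has exactly one child labeled $t$ for each $R$-successor $t$ of $s$; its propositional labeling is inherited from $K$. For a structure $M$ with atomic propositions $AP$ and $x\notin AP$, an $x$-variant of $M$ is a structure identical to $M$ except that it has atomic propositions $AP\cup\{x\}$ with an arbitrary labeling of $x$ on the states. Tree semantics: $K\models_T\forall x\,\varphi$ iff every $x$-variant of $T(K)$ satisfies $\varphi$. $K'$ is $x$-bisimilar to $K$ iff $K'$ has atomic propositions $AP\cup\{x\}$ and there is a relation between states relating the initial states such that related states agree on $AP$ and each transition from one of two related states is matched by a transition of the other to a related state (in both directions); $\mathcal{B}_x(K)$ is the set of all Kripke structures $x$-bisimilar to $K$. Bisimulation semantics: $K\models_b\forall x\,\varphi$ iff $K'\models\varphi$ for all $K'\in\mathcal{B}_x(K)$. *)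

theory Defs
  imports Main
begin

section \<open>Structures\<close>

record ('p, 's) struct =
  props :: "'p set"
  states :: "'s set"
  edges :: "('s \<times> 's) set"
  init :: "'s"
  label :: "'s \<Rightarrow> 'p set"

definition wf_struct :: "('p, 's) struct \<Rightarrow> bool" where
  "wf_struct M \<longleftrightarrow>
     init M \<in> states M \<and>
     edges M \<subseteq> states M \<times> states M \<and>
     (\<forall>s\<in>states M. \<exists>t. (s, t) \<in> edges M) \<and>
     (\<forall>s\<in>states M. label M s \<subseteq> props M)"

definition kripke :: "('p, 's) struct \<Rightarrow> bool" where
  "kripke K \<longleftrightarrow> wf_struct K \<and> finite (states K)"

section \<open>CTL*\<close>

datatype (satoms: 'p) sform =
    STrue
  | Prop 'p
  | SNot "'p sform"
  | SAnd "'p sform" "'p sform"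
  | All "'p pform"
  | Ex "'p pform"
and (patoms: 'p) pform =
    State "'p sform"
  | PNot "'p pform"
  | PAnd "'p pform" "'p pform"
  | Next "'p pform"
  | Until "'p pform" "'p pform"

definition is_path :: "('p, 's) struct \<Rightarrow> 's \<Rightarrow> (nat \<Rightarrow> 's) \<Rightarrow> bool" where
  "is_path M s \<pi> \<longleftrightarrow> \<pi> 0 = s \<and> (\<forall>i. (\<pi> i, \<pi> (Suc i)) \<in> edges M)"

primrec ssat :: "('p, 's) struct \<Rightarrow> 'p sform \<Rightarrow> 's \<Rightarrow> bool"
  and psat :: "('p, 's) struct \<Rightarrow> 'p pform \<Rightarrow> (nat \<Rightarrow> 's) \<Rightarrow> bool"
  where
  "ssat M STrue = (\<lambda>s. True)"
| "ssat M (Prop p) = (\<lambda>s. p \<in> label M s)"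
| "ssat M (SNot \<phi>) = (\<lambda>s. \<not> ssat M \<phi> s)"
| "ssat M (SAnd \<phi> \<phi>') = (\<lambda>s. ssat M \<phi> s \<and> ssat M \<phi>' s)"
| "ssat M (All \<psi>) = (\<lambda>s. \<forall>\<pi>. is_path M s \<pi> \<longrightarrow> psat M \<psi> \<pi>)"
| "ssat M (Ex \<psi>) = (\<lambda>s. \<exists>\<pi>. is_path M s \<pi> \<and> psat M \<psi> \<pi>)"
| "psat M (State \<phi>) = (\<lambda>\<pi>. ssat M \<phi> (\<pi> 0))"
| "psat M (PNot \<psi>) = (\<lambda>\<pi>. \<not> psat M \<psi> \<pi>)"
| "psat M (PAnd \<psi> \<psi>') = (\<lambda>\<pi>. psat M \<psi> \<pi> \<and> psat M \<psi>' \<pi>)"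
| "psat M (Next \<psi>) = (\<lambda>\<pi>. psat M \<psi> (\<lambda>i. \<pi> (Suc i)))"
| "psat M (Until \<psi> \<psi>') = (\<lambda>\<pi>. \<exists>k. psat M \<psi>' (\<lambda>i. \<pi> (k + i)) \<and>
                                    (\<forall>j<k. psat M \<psi> (\<lambda>i. \<pi> (j + i))))"

definition models :: "('p, 's) struct \<Rightarrow> 'p sform \<Rightarrow> bool"  (infix \<open>\<Turnstile>\<close> 50) where
  "M \<Turnstile> \<phi> \<longleftrightarrow> ssat M \<phi> (init M)"

text \<open>LTL formulas are the path formulas of CTL* without path quantifiers.\<close>

primrec propositional :: "'p sform \<Rightarrow> bool" where
  "propositional STrue = True"
| "propositional (Prop p) = True"
| "propositional (SNot \<phi>) = propositional \<phi>"
| "propositional (SAnd \<phi> \<phi>') = (propositional \<phi> \<and> propositional \<phi>')"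
| "propositional (All \<psi>) = False"
| "propositional (Ex \<psi>) = False"

primrec ltl :: "'p pform \<Rightarrow> bool" where
  "ltl (State \<phi>) = propositional \<phi>"
| "ltl (PNot \<psi>) = ltl \<psi>"
| "ltl (PAnd \<psi> \<psi>') = (ltl \<psi> \<and> ltl \<psi>')"
| "ltl (Next \<psi>) = ltl \<psi>"
| "ltl (Until \<psi> \<psi>') = (ltl \<psi> \<and> ltl \<psi>')"

section \<open>Tree semantics\<close>

text \<open>A node of the computation tree is the nonempty list of the states on the branch from
  the root to it; the \<open>S\<close>-label of a node is the last entry. This gives each node labeled \<open>s\<close>
  exactly one child labeled \<open>t\<close> for each successor \<open>t\<close> of \<open>s\<close>.\<close>

inductive_set nodes :: "('p, 's) struct \<Rightarrow> 's list set" for K where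
  root: "[init K] \<in> nodes K"
| child: "w \<in> nodes K \<Longrightarrow> (last w, t) \<in> edges K \<Longrightarrow> w @ [t] \<in> nodes K"

definition comp_tree :: "('p, 's) struct \<Rightarrow> ('p, 's list) struct" where
  "comp_tree K =
     \<lparr> props = props K,
       states = nodes K,
       edges = {(w, w @ [t]) | w t. w \<in> nodes K \<and> (last w, t) \<in> edges K},
       init = [init K],
       label = (\<lambda>w. label K (last w)) \<rparr>"

text \<open>Meant for \<open>x \<notin> props M\<close>.\<close>

definition variant :: "'p \<Rightarrow> ('p, 's) struct \<Rightarrow> ('p, 's) struct \<Rightarrow> bool" where
  "variant x M M' \<longleftrightarrow>
     props M' = insert x (props M) \<and>
     states M' = states M \<and>
     edges M' = edges M \<and>
     init M' = init M \<and>
     (\<forall>s\<in>states M. label M' s - {x} = label M s)"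

definition tree_forall :: "('p, 's) struct \<Rightarrow> 'p \<Rightarrow> 'p sform \<Rightarrow> bool"
    (\<open>(_ \<Turnstile>\<^sub>T \<^bold>\<forall>_./ _)\<close> [51, 51, 51] 50) where
  "K \<Turnstile>\<^sub>T \<^bold>\<forall>x. \<phi> \<longleftrightarrow> (\<forall>M. variant x (comp_tree K) M \<longrightarrow> M \<Turnstile> \<phi>)"

section \<open>Bisimulation semantics\<close>

definition x_bisimilar :: "'p \<Rightarrow> ('p, 's) struct \<Rightarrow> ('p, 't) struct \<Rightarrow> bool" where
  "x_bisimilar x K K' \<longleftrightarrow>
     props K' = insert x (props K) \<and>
     (\<exists>B \<subseteq> states K \<times> states K'.
        (init K, init K') \<in> B \<and>
        (\<forall>(s, s')\<in>B.
           label K s \<inter> props K = label K' s' \<inter> props K \<and>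
           (\<forall>t. (s, t) \<in> edges K \<longrightarrow> (\<exists>t'. (s', t') \<in> edges K' \<and> (t, t') \<in> B)) \<and>
           (\<forall>t'. (s', t') \<in> edges K' \<longrightarrow> (\<exists>t. (s, t) \<in> edges K \<and> (t, t') \<in> B))))"

text \<open>HOL cannot quantify over state types inside a formula. Since Kripke structures are
  finite, each is isomorphic to one whose states are natural numbers, so these represent all
  members of the class; see \<open>bisim_forall_any_type\<close> below.\<close>

definition bisim_class :: "'p \<Rightarrow> ('p, 's) struct \<Rightarrow> ('p, nat) struct set" where
  "bisim_class x K = {K'. kripke K' \<and> x_bisimilar x K K'}"

definition bisim_forall :: "('p, 's) struct \<Rightarrow> 'p \<Rightarrow> 'p sform \<Rightarrow> bool"
    (\<open>(_ \<Turnstile>\<^sub>b \<^bold>\<forall>_./ _)\<close> [51, 51, 51] 50) where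
  "K \<Turnstile>\<^sub>b \<^bold>\<forall>x. \<phi> \<longleftrightarrow> (\<forall>K'\<in>bisim_class x K. K' \<Turnstile> \<phi>)"

subsection \<open>Independence of the state type\<close>

definition rename :: "('s \<Rightarrow> 't) \<Rightarrow> ('p, 's) struct \<Rightarrow> ('p, 't) struct" where
  "rename f M =
     \<lparr> props = props M,
       states = f ` states M,
       edges = map_prod f f ` edges M,
       init = f (init M),
       label = (\<lambda>t. label M (inv_into (states M) f t)) \<rparr>"

lemma rename_path:
  assumes "wf_struct M" "inj_on f (states M)" "s \<in> states M"
    and "is_path (rename f M) (f s) \<rho>"
  obtains \<pi> where "is_path M s \<pi>" "\<rho> = f \<circ> \<pi>"
proof
  let ?g = "inv_into (states M) f"
  have *: "?g (f u) = u" if "u \<in> states M" for u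
    using assms(2) that by (rule inv_into_f_f)
  have e: "(?g (\<rho> i), ?g (\<rho> (Suc i))) \<in> edges M \<and> f (?g (\<rho> i)) = \<rho> i" for i
  proof -
    obtain u v where "(u, v) \<in> edges M" "\<rho> i = f u" "\<rho> (Suc i) = f v"
      using assms(4) by (fastforce simp: is_path_def rename_def)
    with assms(1) * show ?thesis by (auto simp: wf_struct_def)
  qed
  show "is_path M s (?g \<circ> \<rho>)"
    using e assms(3,4) * by (auto simp: is_path_def)
  show "\<rho> = f \<circ> (?g \<circ> \<rho>)" using e by (auto simp: fun_eq_iff)
qed

lemma path_rename:
  "is_path M s \<pi> \<Longrightarrow> is_path (rename f M) (f s) (f \<circ> \<pi>)"
  by (auto simp: is_path_def rename_def)

lemma path_states:
  assumes "wf_struct M" "is_path M s \<pi>"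
  shows "\<pi> i \<in> states M"
  using assms by (auto simp: is_path_def wf_struct_def)

lemma sat_rename:
  fixes \<phi> :: "'p sform" and \<psi> :: "'p pform"
  assumes "wf_struct M" "inj_on f (states M)"
  shows "s \<in> states M \<Longrightarrow> ssat (rename f M) \<phi> (f s) = ssat M \<phi> s"
    and "(\<And>i. \<pi> i \<in> states M) \<Longrightarrow> psat (rename f M) \<psi> (f \<circ> \<pi>) = psat M \<psi> \<pi>"
proof (induction \<phi> and \<psi> arbitrary: s and \<pi>)
  case (Prop p)
  then show ?case using assms by (simp add: rename_def)
next
  case (All \<psi>)
  have "psat (rename f M) \<psi> (f \<circ> \<pi>) = psat M \<psi> \<pi>" if "is_path M s \<pi>" for \<pi>
    using All.IH path_states[OF assms(1) that] by blast
  moreover have "(\<forall>\<rho>. is_path (rename f M) (f s) \<rho> \<longrightarrow> Q \<rho>) \<longleftrightarrow>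
      (\<forall>\<pi>. is_path M s \<pi> \<longrightarrow> Q (f \<circ> \<pi>))" for Q
    using rename_path[OF assms All.prems] path_rename[of M s _ f] by metis
  ultimately show ?case by (simp cong: conj_cong)
next
  case (Ex \<psi>)
  have "psat (rename f M) \<psi> (f \<circ> \<pi>) = psat M \<psi> \<pi>" if "is_path M s \<pi>" for \<pi>
    using Ex.IH path_states[OF assms(1) that] by blast
  moreover have "(\<exists>\<rho>. is_path (rename f M) (f s) \<rho> \<and> Q \<rho>) \<longleftrightarrow>
      (\<exists>\<pi>. is_path M s \<pi> \<and> Q (f \<circ> \<pi>))" for Q
    using rename_path[OF assms Ex.prems] path_rename[of M s _ f] by metis
  ultimately show ?case by (simp cong: conj_cong)
next
  case (Next \<psi>)
  then show ?case using Next.IH[of "\<lambda>i. \<pi> (Suc i)"] by (simp add: comp_def)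
next
  case (Until \<psi> \<psi>')
  have "psat (rename f M) \<psi> (\<lambda>i. f (\<pi> (k + i))) = psat M \<psi> (\<lambda>i. \<pi> (k + i))"
    "psat (rename f M) \<psi>' (\<lambda>i. f (\<pi> (k + i))) = psat M \<psi>' (\<lambda>i. \<pi> (k + i))" for k
    using Until.IH[of "\<lambda>i. \<pi> (k + i)"] Until.prems by (simp_all add: comp_def)
  then show ?case by (simp add: comp_def)
qed simp_all

lemma kripke_rename:
  assumes "kripke M" "inj_on f (states M)"
  shows "kripke (rename f M)"
proof -
  have wf: "init M \<in> states M" "edges M \<subseteq> states M \<times> states M"
    "\<And>s. s \<in> states M \<Longrightarrow> \<exists>t. (s, t) \<in> edges M"
    "\<And>s. s \<in> states M \<Longrightarrow> label M s \<subseteq> props M" and fin: "finite (states M)"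
    using assms(1) by (auto simp: kripke_def wf_struct_def)
  have "\<exists>v. (f s, v) \<in> map_prod f f ` edges M" if "s \<in> states M" for s
    using wf(3)[OF that] by force
  moreover have "map_prod f f ` edges M \<subseteq> f ` states M \<times> f ` states M"
    using wf(2) by auto
  ultimately show ?thesis
    using wf(1,4) fin assms(2) by (simp add: kripke_def wf_struct_def rename_def)
qed

lemma x_bisimilar_rename:
  assumes "wf_struct K'" "inj_on f (states K')" "x_bisimilar x K K'"
  shows "x_bisimilar x K (rename f K')"
proof -
  obtain B where B: "B \<subseteq> states K \<times> states K'" "(init K, init K') \<in> B"
    and props: "props K' = insert x (props K)"
    and bis: "\<forall>(s, s')\<in>B.
      label K s \<inter> props K = label K' s' \<inter> props K \<and>
      (\<forall>t. (s, t) \<in> edges K \<longrightarrow> (\<exists>t'. (s', t') \<in> edges K' \<and> (t, t') \<in> B)) \<and>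
      (\<forall>t'. (s', t') \<in> edges K' \<longrightarrow> (\<exists>t. (s, t) \<in> edges K \<and> (t, t') \<in> B))"
    using assms(3) unfolding x_bisimilar_def by (elim conjE exE) (rule that)
  have lab: "label K s \<inter> props K = label K' s' \<inter> props K" if "(s, s') \<in> B" for s s'
    using bspec[OF bis that] by simp
  have forth: "\<exists>t'. (s', t') \<in> edges K' \<and> (t, t') \<in> B"
    if "(s, s') \<in> B" "(s, t) \<in> edges K" for s s' t
    using bspec[OF bis that(1)] that(2) by simp
  have bck: "\<exists>t. (s, t) \<in> edges K \<and> (t, t') \<in> B"
    if "(s, s') \<in> B" "(s', t') \<in> edges K'" for s s' t'
    using bspec[OF bis that(1)] that(2) by simp
  let ?B = "map_prod id f ` B"
  have E: "(f u, v) \<in> edges (rename f K') \<longleftrightarrow> (\<exists>w. v = f w \<and> (u, w) \<in> edges K')"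
    if "u \<in> states K'" for u v
    using that assms(1,2) by (auto simp: rename_def wf_struct_def dest: inj_onD)
  have "?B \<subseteq> states K \<times> states (rename f K')" "(init K, init (rename f K')) \<in> ?B"
    using B(1) imageI[OF B(2), of "map_prod id f"] by (auto simp: rename_def)
  moreover have 1: "label K s \<inter> props K = label (rename f K') v \<inter> props K \<and>
      (\<forall>t. (s, t) \<in> edges K \<longrightarrow> (\<exists>t'. (v, t') \<in> edges (rename f K') \<and> (t, t') \<in> ?B)) \<and>
      (\<forall>t'. (v, t') \<in> edges (rename f K') \<longrightarrow> (\<exists>t. (s, t) \<in> edges K \<and> (t, t') \<in> ?B))"
    if sv: "(s, v) \<in> ?B" for s v
  proof -
    obtain s' where s': "v = f s'" "(s, s') \<in> B" "s' \<in> states K'" using sv B by auto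
    have "label (rename f K') v = label K' s'"
      using s' assms(2) by (simp add: rename_def)
    moreover have "\<exists>t'. (v, t') \<in> edges (rename f K') \<and> (t, t') \<in> ?B"
      if st: "(s, t) \<in> edges K" for t
    proof -
      obtain t' where t': "(s', t') \<in> edges K'" "(t, t') \<in> B" using forth[OF s'(2) st] by blast
      have "(v, f t') \<in> edges (rename f K')" using E[OF s'(3)] t'(1) s'(1) by blast
      moreover have "(t, f t') \<in> ?B" using imageI[OF t'(2), of "map_prod id f"] by simp
      ultimately show ?thesis by iprover
    qed
    moreover have "\<exists>t. (s, t) \<in> edges K \<and> (t, t') \<in> ?B"
      if vt: "(v, t') \<in> edges (rename f K')" for t'
    proof -
      obtain w where w: "t' = f w" "(s', w) \<in> edges K'" using E[OF s'(3)] vt s'(1) by blast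
      obtain t where t: "(s, t) \<in> edges K" "(t, w) \<in> B" using bck[OF s'(2) w(2)] by blast
      have "(t, t') \<in> ?B" using imageI[OF t(2), of "map_prod id f"] w(1) by simp
      with t(1) show ?thesis by iprover
    qed
    ultimately show ?thesis using lab[OF s'(2)] by simp
  qed
  moreover have "props (rename f K') = insert x (props K)"
    using props by (simp add: rename_def)
  moreover have "\<forall>(s, v)\<in>?B. label K s \<inter> props K = label (rename f K') v \<inter> props K \<and>
      (\<forall>t. (s, t) \<in> edges K \<longrightarrow> (\<exists>t'. (v, t') \<in> edges (rename f K') \<and> (t, t') \<in> ?B)) \<and>
      (\<forall>t'. (v, t') \<in> edges (rename f K') \<longrightarrow> (\<exists>t. (s, t) \<in> edges K \<and> (t, t') \<in> ?B))"
    by (rule ballI, unfold split_paired_all prod.case) (rule 1)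
  ultimately show ?thesis unfolding x_bisimilar_def
    by (intro conjI exI[of _ ?B])
qed

lemma bisim_forall_any_type:
  fixes K :: "('p, 's) struct" and K' :: "('p, 't) struct"
  assumes "K \<Turnstile>\<^sub>b \<^bold>\<forall>x. \<phi>" "kripke K'" "x_bisimilar x K K'"
  shows "K' \<Turnstile> \<phi>"
proof -
  have wf: "wf_struct K'" and fin: "finite (states K')" and i: "init K' \<in> states K'"
    using assms(2) by (auto simp: kripke_def wf_struct_def)
  obtain f :: "'t \<Rightarrow> nat" where f: "inj_on f (states K')"
    using finite_imp_inj_to_nat_seg[OF fin] by blast
  have "rename f K' \<in> bisim_class x K"
    using kripke_rename[OF assms(2) f] x_bisimilar_rename[OF wf f assms(3)]
    by (simp add: bisim_class_def)
  then have "rename f K' \<Turnstile> \<phi>" using assms(1) by (simp add: bisim_forall_def)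
  then show ?thesis
    using sat_rename(1)[OF wf f i] by (simp add: models_def rename_def)
qed

end

theory Submission
  imports Defs
begin

text \<open>Both sides say that \<open>\<psi>\<close> holds on every word obtained from the label sequence of a path of
  \<open>K\<close> by decorating its positions arbitrarily with \<open>x\<close>. In the tree this is because the nodes of
  a branch are distinct. For the bisimulation semantics, a violating word may be taken ultimately
  periodic: cut it between two positions at which the same subformulas of \<open>\<psi>\<close> hold and the same
  state is visited, far enough apart for every pending eventuality to be met in between. The
  resulting lasso, with the transitions of \<open>K\<close> as exits into a copy of \<open>K\<close>, is a finite
  structure \<open>x\<close>-bisimilar to \<open>K\<close>.\<close>

section \<open>LTL and label sequences\<close>

lemma propositional_cong:
  "propositional \<phi> \<Longrightarrow> label M s = label M' s' \<Longrightarrow> ssat M \<phi> s = ssat M' \<phi> s'"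
  by (induction \<phi> rule: sform.induct[where ?P2.0 = "\<lambda>_. True"]) auto

text \<open>Without path quantifiers, evaluation never consults the edges, so it sees nothing but
  the label sequence. This allows comparison across different state types.\<close>

lemma ltl_cong:
  "ltl \<psi> \<Longrightarrow> (\<And>i. label M (\<pi> i) = label M' (\<pi>' i)) \<Longrightarrow> psat M \<psi> \<pi> = psat M' \<psi> \<pi>'"
proof (induction \<psi> arbitrary: \<pi> \<pi>' rule: pform.induct[where ?P1.0 = "\<lambda>_. True"])
  case (State \<phi>)
  then show ?case using propositional_cong[of \<phi> M "\<pi> 0" M' "\<pi>' 0"] by simp
next
  case (PNot \<psi>)
  then have "psat M \<psi> \<pi> = psat M' \<psi> \<pi>'" by (intro PNot.IH) auto
  then show ?case by simp
next
  case (PAnd \<psi> \<psi>')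
  then have "psat M \<psi> \<pi> = psat M' \<psi> \<pi>'" by (intro PAnd.IH(1)) auto
  moreover have "psat M \<psi>' \<pi> = psat M' \<psi>' \<pi>'"
    using PAnd.prems by (intro PAnd.IH(2)) auto
  ultimately show ?case by simp
next
  case (Next \<psi>)
  then have "psat M \<psi> (\<lambda>i. \<pi> (Suc i)) = psat M' \<psi> (\<lambda>i. \<pi>' (Suc i))"
    by (intro Next.IH) auto
  then show ?case by simp
next
  case (Until \<psi> \<psi>')
  have "psat M \<psi> (\<lambda>i. \<pi> (k + i)) = psat M' \<psi> (\<lambda>i. \<pi>' (k + i))"
    "psat M \<psi>' (\<lambda>i. \<pi> (k + i)) = psat M' \<psi>' (\<lambda>i. \<pi>' (k + i))" for k
    using Until.prems by (intro Until.IH; simp)+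
  then show ?case by simp
qed simp_all

text \<open>The expansion law, phrased with offsets into one fixed sequence, since the lasso
  argument works with positions of the original path.\<close>

lemma until_unfold:
  "psat M (Until \<psi> \<psi>') (\<lambda>i. \<pi> (k + i)) \<longleftrightarrow>
    psat M \<psi>' (\<lambda>i. \<pi> (k + i)) \<or>
    psat M \<psi> (\<lambda>i. \<pi> (k + i)) \<and> psat M (Until \<psi> \<psi>') (\<lambda>i. \<pi> (Suc k + i))"
  (is "?U k \<longleftrightarrow> ?B k \<or> ?A k \<and> ?U (Suc k)")
proof -
  have U: "?U k \<longleftrightarrow> (\<exists>m. ?B (k + m) \<and> (\<forall>j<m. ?A (k + j)))" for k
    by (simp add: add.assoc)
  show ?thesis unfolding U
  proof (intro iffI; elim disjE conjE exE)
    fix m assume m: "?B (k + m)" "\<forall>j<m. ?A (k + j)"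
    show "?B k \<or> ?A k \<and> (\<exists>m. ?B (Suc k + m) \<and> (\<forall>j<m. ?A (Suc k + j)))"
    proof (cases m)
      case 0
      then show ?thesis using m(1) by simp
    next
      case (Suc m')
      then have "?B (Suc k + m')" "\<forall>j<m'. ?A (Suc k + j)" "?A k"
        using m by (auto simp: All_less_Suc2)
      then show ?thesis by blast
    qed
  next
    assume "?B k"
    then show "\<exists>m. ?B (k + m) \<and> (\<forall>j<m. ?A (k + j))" by (intro exI[of _ 0]) simp
  next
    fix m assume "?A k" "?B (Suc k + m)" "\<forall>j<m. ?A (Suc k + j)"
    then show "\<exists>m. ?B (k + m) \<and> (\<forall>j<m. ?A (k + j))"
      by (intro exI[of _ "Suc m"]) (simp add: All_less_Suc2)
  qed
qed

section \<open>Ultimately periodic models\<close>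

text \<open>State formulas are leaves: the lasso step and its original position share the same
  state, so nothing below them needs comparing.\<close>

primrec subs :: "'p pform \<Rightarrow> 'p pform set" where
  "subs (State \<phi>) = {State \<phi>}"
| "subs (PNot \<psi>) = insert (PNot \<psi>) (subs \<psi>)"
| "subs (PAnd \<psi> \<psi>') = insert (PAnd \<psi> \<psi>') (subs \<psi> \<union> subs \<psi>')"
| "subs (Next \<psi>) = insert (Next \<psi>) (subs \<psi>)"
| "subs (Until \<psi> \<psi>') = insert (Until \<psi> \<psi>') (subs \<psi> \<union> subs \<psi>')"

lemma finite_subs: "finite (subs \<psi>)"
  by (induction \<psi> rule: pform.induct[where ?P1.0 = "\<lambda>_. True"]) auto

lemma self_in_subs: "\<psi> \<in> subs \<psi>"
  by (cases \<psi>) auto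

text \<open>The position in the original path of step \<open>i\<close> of the lasso with stem \<open>[0, n)\<close> and loop
  \<open>[n, q)\<close>.\<close>

definition lasso :: "nat \<Rightarrow> nat \<Rightarrow> nat \<Rightarrow> nat" where
  "lasso n q i = (if i < n then i else n + (i - n) mod (q - n))"

lemma lasso_0: "lasso n q 0 = 0"
  by (simp add: lasso_def)

lemma lasso_less: "n < q \<Longrightarrow> lasso n q i < q"
  using mod_less_divisor[of "q - n" "i - n"] by (auto simp add: lasso_def simp del: mod_less_divisor)

lemma lasso_Suc:
  assumes "n < q"
  shows "lasso n q (Suc i) = (if Suc (lasso n q i) = q then n else Suc (lasso n q i))"
proof (cases "i < n")
  case True
  then show ?thesis using assms by (cases "Suc i = n") (auto simp: lasso_def)
next
  case False
  then show ?thesis using assms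
    by (auto simp: lasso_def Suc_diff_le mod_Suc)
qed

lemma lasso_visits:
  assumes "n \<le> m" "m < q"
  shows "\<exists>k. lasso n q (i + k) = m"
proof -
  \<comment> \<open>Going round the loop \<open>i\<close> more times leaves the position
    \<open>m\<close> unchanged and, as the loop has length at least 1, reaches step \<open>i\<close>
    or later.\<close>
  let ?j = "m + (q - n) * i"
  have "i \<le> ?j" using assms by (cases "q - n") auto
  moreover have "lasso n q ?j = m"
  proof -
    have "?j - n = (m - n) + (q - n) * i" using assms by simp
    then have "(?j - n) mod (q - n) = (m - n) mod (q - n)" by (simp only: mod_mult_self2)
    also have "\<dots> = m - n" using assms by (intro mod_less) simp
    finally have "(?j - n) mod (q - n) = m - n" .
    then show ?thesis using assms by (simp add: lasso_def)
  qed
  ultimately show ?thesis by (metis le_add_diff_inverse)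
qed

text \<open>Truth at a lasso step equals truth at its position in the original path.
  \<open>same\<close> makes the jump from \<open>q - 1\<close> back to \<open>n\<close> invisible to
  subformulas; \<open>met\<close> prevents an until from being postponed forever around the
  loop.\<close>

lemma psat_lasso:
  assumes nq: "n < q"
    and same: "\<And>\<chi>. \<chi> \<in> subs \<psi> \<Longrightarrow>
      psat M \<chi> (\<lambda>j. \<pi> (n + j)) = psat M \<chi> (\<lambda>j. \<pi> (q + j))"
    and met: "\<And>\<chi> k. \<chi> \<in> subs \<psi> \<Longrightarrow> n \<le> k \<Longrightarrow> psat M \<chi> (\<lambda>j. \<pi> (k + j)) \<Longrightarrow>
      \<exists>m. n \<le> m \<and> m < q \<and> psat M \<chi> (\<lambda>j. \<pi> (m + j))"
  shows "psat M \<psi> (\<lambda>j. \<pi> (lasso n q (i + j))) = psat M \<psi> (\<lambda>j. \<pi> (lasso n q i + j))"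
  using same met
proof (induction \<psi> arbitrary: i rule: pform.induct[where ?P1.0 = "\<lambda>_. True"])
  case (PNot \<psi>)
  then show ?case by simp
next
  case (PAnd \<psi> \<psi>')
  have "psat M \<psi> (\<lambda>j. \<pi> (lasso n q (i + j))) = psat M \<psi> (\<lambda>j. \<pi> (lasso n q i + j))"
    by (rule PAnd.IH(1), rule PAnd.prems(1), simp, rule PAnd.prems(2), simp)
  moreover have "psat M \<psi>' (\<lambda>j. \<pi> (lasso n q (i + j))) = psat M \<psi>' (\<lambda>j. \<pi> (lasso n q i + j))"
    by (rule PAnd.IH(2), rule PAnd.prems(1), simp, rule PAnd.prems(2), simp)
  ultimately show ?case by simp
next
  case (Next \<psi>)
  have "psat M \<psi> (\<lambda>j. \<pi> (lasso n q (Suc i + j))) =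
      psat M \<psi> (\<lambda>j. \<pi> (lasso n q (Suc i) + j))"
    by (rule Next.IH, rule Next.prems(1), simp, rule Next.prems(2), simp)
  \<comment> \<open>At the jump the lasso continues at \<open>n\<close> and the original path at
    \<open>q\<close>; \<open>same\<close> identifies the two.\<close>
  also have "\<dots> = psat M \<psi> (\<lambda>j. \<pi> (Suc (lasso n q i) + j))"
    using Next.prems(1)[of \<psi>] by (cases "Suc (lasso n q i) = q") (simp_all add: lasso_Suc[OF nq] self_in_subs del: add_Suc)
  finally show ?case by simp
next
  case (Until \<psi> \<psi>')
  let ?U = "\<lambda>k. psat M (Until \<psi> \<psi>') (\<lambda>j. \<pi> (k + j))"
  let ?A = "\<lambda>k. psat M \<psi> (\<lambda>j. \<pi> (k + j))"
  let ?B = "\<lambda>k. psat M \<psi>' (\<lambda>j. \<pi> (k + j))"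
  let ?g = "lasso n q"
  have A: "psat M \<psi> (\<lambda>j. \<pi> (?g (i + j))) = ?A (?g i)" for i
    by (rule Until.IH(1), rule Until.prems(1), simp, rule Until.prems(2), simp)
  have B: "psat M \<psi>' (\<lambda>j. \<pi> (?g (i + j))) = ?B (?g i)" for i
    by (rule Until.IH(2), rule Until.prems(1), simp, rule Until.prems(2), simp)
  have L: "psat M (Until \<psi> \<psi>') (\<lambda>j. \<pi> (?g (i + j))) \<longleftrightarrow>
      (\<exists>m. ?B (?g (i + m)) \<and> (\<forall>j<m. ?A (?g (i + j))))"
    unfolding psat.simps A[symmetric] B[symmetric] by (simp only: add.assoc)
  \<comment> \<open>This lets the expansion law of the original until be read along the lasso, even
    across the jump.\<close>
  have "?U n = ?U q" by (rule Until.prems(1)) simp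
  then have step: "?U (?g i) \<longleftrightarrow> ?B (?g i) \<or> ?A (?g i) \<and> ?U (?g (Suc i))" for i
    by (subst until_unfold, cases "Suc (?g i) = q")
      (simp_all add: lasso_Suc[OF nq] del: psat.simps add_Suc)
  show ?case unfolding L
  proof
    assume "\<exists>m. ?B (?g (i + m)) \<and> (\<forall>j<m. ?A (?g (i + j)))"
    then obtain m where "?B (?g (i + m))" "\<forall>j<m. ?A (?g (i + j))" by blast
    then show "?U (?g i)"
    proof (induction m arbitrary: i)
      case 0
      then show ?case using step[of i] by simp
    next
      case (Suc m)
      have "?U (?g (Suc i))" using Suc.prems by (intro Suc.IH) auto
      moreover have "?A (?g i)" using Suc.prems(2) by force
      ultimately show ?case using step[of i] by blast
    qed
  next
    assume U: "?U (?g i)"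
    show "\<exists>m. ?B (?g (i + m)) \<and> (\<forall>j<m. ?A (?g (i + j)))"
    proof (rule ccontr)
      assume no: "\<not> ?thesis"
      \<comment> \<open>An until never fulfilled on the lasso stays pending at every step, in
        particular on a visit to \<open>n\<close>. There the original path promises a later \<psi>';
        \<open>met\<close> moves it into the loop, and the lasso reaches it.\<close>
      have run: "?U (?g (i + k)) \<and> (\<forall>j<k. ?A (?g (i + j)))" for k
      proof (induction k)
        case 0
        then show ?case using U by simp
      next
        case (Suc k)
        then have "\<not> ?B (?g (i + k))" using no by blast
        then show ?case using Suc step[of "i + k"] by (simp add: less_Suc_eq_le le_less del: psat.simps)
      qed
      obtain k where "?g (i + k) = n" using lasso_visits[of n n q i] nq by auto
      then have "?U n" using run by metis
      then obtain m where "?B (n + m)" by (auto simp: add.assoc)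
      then obtain m' where m': "n \<le> m'" "m' < q" "?B m'"
        using Until.prems(2)[of \<psi>' "n + m"] self_in_subs[of \<psi>'] by auto
      then obtain k where "?g (i + k) = m'" using lasso_visits[of n m' q i] by auto
      then have "?B (?g (i + k))" using m'(3) by simp
      then show False using no run[of k] by blast
    qed
  qed
qed simp_all

text \<open>Pigeonhole on the set of true subformulas paired with a colour \<open>c k\<close>. The
  colour will be the visited state of the Kripke structure, so that the loop closes by a real
  transition.\<close>

lemma lasso_exists:
  fixes c :: "nat \<Rightarrow> 'c"
  assumes "finite (range c)"
  obtains n q where "n < q" "c n = c q"
    and "psat M \<psi> (\<lambda>j. \<pi> (lasso n q j)) = psat M \<psi> \<pi>"
proof -
  let ?T = "\<lambda>k. {\<chi> \<in> subs \<psi>. psat M \<chi> (\<lambda>j. \<pi> (k + j))}"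
  let ?d = "\<lambda>k. (?T k, c k)"
  have "finite (range ?d)"
    by (rule finite_subset[of _ "Pow (subs \<psi>) \<times> range c"]) (auto simp: assms finite_subs)
  from pigeonhole_infinite[OF infinite_UNIV_nat this]
  obtain n where inf: "infinite {k. ?d k = ?d n}" by auto
  \<comment> \<open>\<open>f\<close> picks one position from \<open>n\<close> on for each formula
    that holds at some such position. Finitely many subformulas give a bound \<open>b\<close>, and a
    recurrence \<open>q\<close> beyond \<open>b\<close> ensures the condition
    \<open>met\<close>.\<close>
  have "\<exists>f. \<forall>\<chi>. (\<exists>k\<ge>n. psat M \<chi> (\<lambda>j. \<pi> (k + j))) \<longrightarrow>
      n \<le> f \<chi> \<and> psat M \<chi> (\<lambda>j. \<pi> (f \<chi> + j))"
    by (rule choice) blast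
  then obtain f where f: "\<And>\<chi> k. n \<le> k \<Longrightarrow> psat M \<chi> (\<lambda>j. \<pi> (k + j)) \<Longrightarrow>
      n \<le> f \<chi> \<and> psat M \<chi> (\<lambda>j. \<pi> (f \<chi> + j))" by blast
  obtain b where b: "\<forall>m \<in> insert n (f ` subs \<psi>). m \<le> b"
    using finite_subs[of \<psi>] finite_nat_set_iff_bounded_le[of "insert n (f ` subs \<psi>)"] by auto
  obtain q where q: "b < q" "?d q = ?d n"
    using inf unfolding finite_nat_set_iff_bounded_le by (auto simp: not_le)
  have nq: "n < q" using b q(1) by auto
  have "psat M \<psi> (\<lambda>j. \<pi> (lasso n q (0 + j))) = psat M \<psi> (\<lambda>j. \<pi> (lasso n q 0 + j))"
  proof (rule psat_lasso[OF nq])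
    show "psat M \<chi> (\<lambda>j. \<pi> (n + j)) = psat M \<chi> (\<lambda>j. \<pi> (q + j))" if "\<chi> \<in> subs \<psi>" for \<chi>
      using q(2) that by auto
    show "\<exists>m. n \<le> m \<and> m < q \<and> psat M \<chi> (\<lambda>j. \<pi> (m + j))"
      if "\<chi> \<in> subs \<psi>" "n \<le> k" "psat M \<chi> (\<lambda>j. \<pi> (k + j))" for \<chi> k
    proof -
      have "f \<chi> \<le> b" using b that(1) by blast
      then show ?thesis using f[OF that(2,3)] q(1) by (intro exI[of _ "f \<chi>"]) simp
    qed
  qed
  then show ?thesis using that[OF nq] q(2) by (simp add: lasso_0)
qed

section \<open>Decorated paths\<close>

text \<open>Lets \<open>psat\<close> double as LTL satisfaction on words: the states are the
  positions, and the identity sequence reads the word.\<close>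

definition word :: "(nat \<Rightarrow> 'p set) \<Rightarrow> ('p, nat) struct" where
  "word \<sigma> = \<lparr> props = {}, states = {}, edges = {}, init = 0, label = \<sigma> \<rparr>"

definition wsat :: "(nat \<Rightarrow> 'p set) \<Rightarrow> 'p pform \<Rightarrow> bool" where
  "wsat \<sigma> \<psi> \<longleftrightarrow> psat (word \<sigma>) \<psi> (\<lambda>i. i)"

lemma psat_wsat: "ltl \<psi> \<Longrightarrow> psat M \<psi> \<pi> \<longleftrightarrow> wsat (\<lambda>i. label M (\<pi> i)) \<psi>"
  unfolding wsat_def by (rule ltl_cong) (simp_all add: word_def)

definition decorated :: "('p, 's) struct \<Rightarrow> 'p \<Rightarrow> (nat \<Rightarrow> 's) \<Rightarrow> (nat \<Rightarrow> 'p set) \<Rightarrow> bool" where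
  "decorated K x \<pi> \<sigma> \<longleftrightarrow> is_path K (init K) \<pi> \<and> (\<forall>i. \<sigma> i - {x} = label K (\<pi> i))"

section \<open>Tree semantics and decorated paths\<close>

lemma nodes_last: "wf_struct K \<Longrightarrow> w \<in> nodes K \<Longrightarrow> last w \<in> states K"
  by (erule nodes.cases) (auto simp: wf_struct_def)

lemma tree_forall_decorated:
  assumes "ltl \<psi>" and wf: "wf_struct K" and x: "x \<notin> props K"
    and sat: "K \<Turnstile>\<^sub>T \<^bold>\<forall>x. All \<psi>" and dec: "decorated K x \<pi> \<sigma>"
  shows "wsat \<sigma> \<psi>"
proof -
  have path: "is_path K (init K) \<pi>" and \<sigma>: "\<And>i. \<sigma> i - {x} = label K (\<pi> i)"
    using dec by (auto simp: decorated_def)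
  have xl: "x \<notin> label K s" if "s \<in> states K" for s
    using wf x that by (auto simp: wf_struct_def)
  \<comment> \<open>Decorating by depth suffices, as only the branch along \<open>\<pi>\<close> matters.\<close>
  define M where "M = (comp_tree K)\<lparr> props := insert x (props K),
    label := \<lambda>w. label K (last w) \<union> (\<sigma> (length w - 1) \<inter> {x}) \<rparr>"
  have "variant x (comp_tree K) M"
    using xl nodes_last[OF wf] by (auto simp: variant_def M_def comp_tree_def)
  then have "M \<Turnstile> All \<psi>" using sat by (simp add: tree_forall_def)
  \<comment> \<open>The branch along \<pi>. Its node \<open>\<rho> i\<close> has length
    \<open>Suc i\<close>, so \<open>length w - 1\<close> in \<open>M\<close> recovers
    \<open>i\<close>.\<close>
  define \<rho> where "\<rho> i = map \<pi> [0..<Suc i]" for i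
  have nodes: "\<rho> i \<in> nodes K" for i
  proof (induction i)
    case 0
    then show ?case using path nodes.root[of K] by (simp add: \<rho>_def is_path_def)
  next
    case (Suc i)
    then have "\<rho> i @ [\<pi> (Suc i)] \<in> nodes K"
      using path by (intro nodes.child) (auto simp: \<rho>_def is_path_def)
    then show ?case by (simp add: \<rho>_def)
  qed
  have "is_path M (init M) \<rho>"
    using path nodes by (auto simp: is_path_def M_def comp_tree_def \<rho>_def)
  then have "psat M \<psi> \<rho>" using \<open>M \<Turnstile> All \<psi>\<close> by (simp add: models_def)
  moreover have "label M (\<rho> i) = \<sigma> i" for i
    using \<sigma>[of i] by (auto simp: M_def \<rho>_def)
  ultimately show ?thesis using psat_wsat[OF assms(1), of M \<rho>] by simp
qed

text \<open>Taking last entries projects a tree path to a path of \<open>K\<close>, which the labels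
  of the variant decorate.\<close>

lemma decorated_tree_forall:
  assumes "ltl \<psi>" and sat: "\<And>\<pi> \<sigma>. decorated K x \<pi> \<sigma> \<Longrightarrow> wsat \<sigma> \<psi>"
  shows "K \<Turnstile>\<^sub>T \<^bold>\<forall>x. All \<psi>"
  unfolding tree_forall_def models_def ssat.simps
proof (intro allI impI)
  fix M \<rho>
  assume M: "variant x (comp_tree K) M" and \<rho>: "is_path M (init M) \<rho>"
  have e: "\<rho> i \<in> nodes K \<and> (last (\<rho> i), last (\<rho> (Suc i))) \<in> edges K" for i
    using M \<rho> by (fastforce simp: variant_def comp_tree_def is_path_def)
  have "last (\<rho> 0) = init K"
    using M \<rho> by (simp add: variant_def comp_tree_def is_path_def)
  then have "decorated K x (\<lambda>i. last (\<rho> i)) (\<lambda>i. label M (\<rho> i))"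
    using e M by (auto simp: decorated_def is_path_def variant_def comp_tree_def)
  then show "psat M \<psi> \<rho>" using sat psat_wsat[OF assms(1)] by blast
qed

section \<open>Bisimulation semantics and decorated paths\<close>

lemma decorated_bisim_forall:
  assumes "ltl \<psi>" and wf: "wf_struct K" and x: "x \<notin> props K"
    and sat: "\<And>\<pi> \<sigma>. decorated K x \<pi> \<sigma> \<Longrightarrow> wsat \<sigma> \<psi>"
  shows "K \<Turnstile>\<^sub>b \<^bold>\<forall>x. All \<psi>"
  unfolding bisim_forall_def models_def ssat.simps
proof (intro ballI allI impI)
  fix K' \<rho>
  assume K': "K' \<in> bisim_class x K" and \<rho>: "is_path K' (init K') \<rho>"
  then have wf': "wf_struct K'" by (simp add: bisim_class_def kripke_def)
  obtain B where B: "B \<subseteq> states K \<times> states K'" "(init K, init K') \<in> B"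
    and props: "props K' = insert x (props K)"
    and bis: "\<forall>(s, s')\<in>B.
      label K s \<inter> props K = label K' s' \<inter> props K \<and>
      (\<forall>t. (s, t) \<in> edges K \<longrightarrow> (\<exists>t'. (s', t') \<in> edges K' \<and> (t, t') \<in> B)) \<and>
      (\<forall>t'. (s', t') \<in> edges K' \<longrightarrow> (\<exists>t. (s, t) \<in> edges K \<and> (t, t') \<in> B))"
    using K' unfolding bisim_class_def x_bisimilar_def by blast
  have lab: "label K' s' - {x} = label K s" if "(s, s') \<in> B" for s s'
  proof -
    have "label K s \<inter> props K = label K' s' \<inter> props K" using bspec[OF bis that] by simp
    moreover have "label K s \<subseteq> props K" "label K' s' \<subseteq> insert x (props K)"
      using wf wf' B(1) that props by (auto simp: wf_struct_def)
    ultimately show ?thesis using x by blast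
  qed
  \<comment> \<open>The back condition pulls \<rho> to a path of \<open>K\<close> step by step. The
    clause for \<open>i = 0\<close> pins the start, as \<open>B\<close> may relate several states to
    \<open>\<rho> 0\<close>.\<close>
  have "\<exists>\<pi>. \<forall>i. ((\<pi> i, \<rho> i) \<in> B \<and> (i = 0 \<longrightarrow> \<pi> i = init K)) \<and> (\<pi> i, \<pi> (Suc i)) \<in> edges K"
  proof (rule dependent_nat_choice)
    show "\<exists>s. (s, \<rho> 0) \<in> B \<and> (0 = (0::nat) \<longrightarrow> s = init K)"
      using B(2) \<rho> by (auto simp: is_path_def)
    fix s i assume s: "(s, \<rho> i) \<in> B \<and> (i = 0 \<longrightarrow> s = init K)"
    moreover have "(\<rho> i, \<rho> (Suc i)) \<in> edges K'" using \<rho> by (simp add: is_path_def)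
    ultimately show "\<exists>t. ((t, \<rho> (Suc i)) \<in> B \<and> (Suc i = 0 \<longrightarrow> t = init K)) \<and> (s, t) \<in> edges K"
      using bspec[OF bis, of "(s, \<rho> i)"] by auto
  qed
  then obtain \<pi> where "\<And>i. (\<pi> i, \<rho> i) \<in> B" "is_path K (init K) \<pi>"
    by (auto simp: is_path_def)
  then have "decorated K x \<pi> (\<lambda>i. label K' (\<rho> i))" by (simp add: decorated_def lab)
  then show "psat K' \<psi> \<rho>" using sat psat_wsat[OF assms(1)] by blast
qed

text \<open>The word \<sigma> may be aperiodic and thus fit on no finite structure; a lasso through
  it gives \<psi> the same truth value and does fit.\<close>

lemma bisim_forall_decorated:
  assumes "ltl \<psi>" and K: "kripke K"
    and sat: "K \<Turnstile>\<^sub>b \<^bold>\<forall>x. All \<psi>" and dec: "decorated K x \<pi> \<sigma>" and x: "x \<notin> props K"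
  shows "wsat \<sigma> \<psi>"
proof -
  have path: "is_path K (init K) \<pi>" and \<sigma>: "\<And>i. \<sigma> i - {x} = label K (\<pi> i)"
    using dec by (auto simp: decorated_def)
  have wf: "wf_struct K" and fin: "finite (states K)" using K by (auto simp: kripke_def)
  then have edges: "edges K \<subseteq> states K \<times> states K"
    and total: "\<And>s. s \<in> states K \<Longrightarrow> \<exists>t. (s, t) \<in> edges K"
    and labels: "\<And>s. s \<in> states K \<Longrightarrow> label K s \<subseteq> props K" by (auto simp: wf_struct_def)
  have \<pi>: "\<pi> i \<in> states K" "(\<pi> i, \<pi> (Suc i)) \<in> edges K" for i
    using path_states[OF wf path] path by (auto simp: is_path_def)
  have "finite (range \<pi>)" by (rule finite_subset[OF _ fin]) (use \<pi> in auto)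
  then obtain n q where nq: "n < q" "\<pi> n = \<pi> q"
    and lasso: "psat (word \<sigma>) \<psi> (\<lambda>j. lasso n q j) = psat (word \<sigma>) \<psi> (\<lambda>j. j)"
    by (rule lasso_exists[of \<pi> "word \<sigma>" \<psi> "\<lambda>j. j"])
  define nx where "nx i = (if Suc i = q then n else Suc i)" for i
  \<comment> \<open>\<open>h\<close> projects lasso positions and the copy to \<open>K\<close>;
    pairing each state with its image gives the bisimulation. Every transition of \<open>h u\<close>
    becomes an edge from \<open>u\<close> into the copy, which gives the forth condition; every edge
    of \<open>K'\<close> projects to an edge of \<open>K\<close>, which gives the back
    condition.\<close>
  define h where "h = case_sum \<pi> (\<lambda>s. s)"
  define S where "S = Inl ` {..<q} \<union> Inr ` states K"
  define K' where "K' = \<lparr> props = insert x (props K), states = S,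
    edges = {(Inl i, Inl (nx i)) | i. i < q} \<union> {(u, Inr t) | u t. u \<in> S \<and> (h u, t) \<in> edges K},
    init = Inl 0, label = case_sum \<sigma> (label K) \<rparr>"
  have hS: "h u \<in> states K" if "u \<in> S" for u
    using that \<pi>(1) by (auto simp: S_def h_def)
  \<comment> \<open>At \<open>i = q - 1\<close> the edge is the transition from
    \<open>\<pi> i\<close> to \<open>\<pi> q\<close>, by \<open>\<pi> n = \<pi> q\<close>.\<close>
  have nx: "nx i < q" "(\<pi> i, \<pi> (nx i)) \<in> edges K" if "i < q" for i
    using that nq \<pi>(2)[of i] by (auto simp: nx_def)
  have lab: "label K' u - {x} = label K (h u)" if "u \<in> S" for u
    using that \<sigma> labels x by (fastforce simp: S_def K'_def h_def)
  have edge: "v \<in> S \<and> (h u, h v) \<in> edges K" if "(u, v) \<in> edges K'" for u v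
    using that nx edges by (auto simp: K'_def h_def S_def)
  have "wf_struct K'"
    unfolding wf_struct_def
  proof (intro conjI ballI)
    show "init K' \<in> states K'" using nq(1) by (simp add: K'_def S_def)
    show "edges K' \<subseteq> states K' \<times> states K'"
      using nx(1) edges by (auto simp: K'_def S_def)
    fix u assume "u \<in> states K'"
    then have u: "u \<in> S" by (simp add: K'_def)
    show "\<exists>v. (u, v) \<in> edges K'" using total[OF hS[OF u]] u by (auto simp: K'_def)
    show "label K' u \<subseteq> props K'"
      using lab[OF u] labels[OF hS[OF u]] by (auto simp: K'_def)
  qed
  then have kK': "kripke K'" using fin by (simp add: kripke_def K'_def S_def)
  have "x_bisimilar x K K'"
    unfolding x_bisimilar_def
  proof (intro conjI exI[of _ "{(h u, u) | u. u \<in> S}"])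
    show "props K' = insert x (props K)" by (simp add: K'_def)
    show "{(h u, u) | u. u \<in> S} \<subseteq> states K \<times> states K'" using hS by (auto simp: K'_def)
    show "(init K, init K') \<in> {(h u, u) | u. u \<in> S}"
      using path nq(1) by (auto simp: K'_def h_def S_def is_path_def)
    show "\<forall>(s, s')\<in>{(h u, u) | u. u \<in> S}.
        label K s \<inter> props K = label K' s' \<inter> props K \<and>
        (\<forall>t. (s, t) \<in> edges K \<longrightarrow>
          (\<exists>t'. (s', t') \<in> edges K' \<and> (t, t') \<in> {(h u, u) | u. u \<in> S})) \<and>
        (\<forall>t'. (s', t') \<in> edges K' \<longrightarrow>
          (\<exists>t. (s, t) \<in> edges K \<and> (t, t') \<in> {(h u, u) | u. u \<in> S}))"
    proof (clarify, intro conjI allI impI)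
      fix u assume u: "u \<in> S"
      show "label K (h u) \<inter> props K = label K' u \<inter> props K" using lab[OF u] x by blast
      show "\<exists>t'. (u, t') \<in> edges K' \<and> (t, t') \<in> {(h u, u) | u. u \<in> S}"
        if "(h u, t) \<in> edges K" for t
        using that u edges by (intro exI[of _ "Inr t"]) (auto simp: K'_def h_def S_def)
      show "\<exists>t. (h u, t) \<in> edges K \<and> (t, t') \<in> {(h u, u) | u. u \<in> S}"
        if "(u, t') \<in> edges K'" for t'
        using edge[OF that] by blast
    qed
  qed
  \<comment> \<open>The states of \<open>K'\<close> have a sum type, while the class ranges over
    \<open>nat\<close>; renaming bridges the gap.\<close>
  from bisim_forall_any_type[OF sat kK' this] have "K' \<Turnstile> All \<psi>" .
  moreover have "is_path K' (init K') (\<lambda>i. Inl (lasso n q i))"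
    using lasso_less[OF nq(1)] lasso_Suc[OF nq(1)]
    by (auto simp: is_path_def K'_def lasso_0 nx_def)
  ultimately have "psat K' \<psi> (\<lambda>i. Inl (lasso n q i))" by (simp add: models_def)
  also have "psat K' \<psi> (\<lambda>i. Inl (lasso n q i)) = psat (word \<sigma>) \<psi> (\<lambda>i. lasso n q i)"
    by (rule ltl_cong[OF assms(1)]) (simp add: K'_def word_def)
  finally show ?thesis using lasso by (simp add: wsat_def)
qed

theorem theorem6p2:
  fixes K :: "('p, 's) struct" and \<psi> :: "'p pform" and x :: 'p
  assumes "ltl \<psi>"
    and "x \<in> patoms \<psi>"
    and "kripke K"
    and "x \<notin> props K"
  shows "K \<Turnstile>\<^sub>T \<^bold>\<forall>x. All \<psi> \<longleftrightarrow> K \<Turnstile>\<^sub>b \<^bold>\<forall>x. All \<psi>"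
proof -
  have wf: "wf_struct K" using assms(3) by (simp add: kripke_def)
  show ?thesis
    using tree_forall_decorated[OF assms(1) wf assms(4)] decorated_tree_forall[OF assms(1)]
      decorated_bisim_forall[OF assms(1) wf assms(4)]
      bisim_forall_decorated[OF assms(1,3) _ _ assms(4)]
    by blast
qed

end
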